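(* Let $X$ be a Banach space, $(A_n)_{n\in\mathbb Z}$ a sequence in $\mathcal B(X)$, $\mu=(\mu_n)_{n\in\mathbb Z}$ a growth rate and $\nu=(\nu_n)_{n\in\mathbb Z}$ a sequence with $\nu_n\ge1$ for all $n$. Suppose that $(A_n)_{n\in\mathbb Z}$ admits a $(\mu,\nu)$-dichotomy with respect to projections $P_n$, $n\in\mathbb Z$, and let $\lambda>0$ be an exponent for which (with some $D>0$) the two dichotomy estimates hold. Suppose moreover that there exists $\varepsilon\in[0,\lambda)$ such that \[\sup_{n\in\mathbb N}(\mu_{-n}^{\varepsilon}\nu_{-n})<+\infty\quad\text{and}\quad\sup_{n\in\mathbb N}(\mu_n^{-\varepsilon}\nu_n)<+\infty.\] Then, for each $\beta\in(-(\lambda-\varepsilon),\lambda-\varepsilon)$ the following holds: (1) for every $\mathbf y=(y_n)_{n\in\mathbb Z}\in\ell^1_\beta$ there exists a unique $\mathbf x=(x_n)_{n\in\mathbb Z}\in\ell^\infty_\beta$ such that $x_{n+1}-A_nx_n=y_{n+1}$ for all $n\in\mathbb Z$; (2) for every $\mathbf y=(y_n)_{n\in\mathbb Z}\in\ell^1_{\beta,|\cdot|}$ there exists a unique $\mathbf x=(x_n)_{n\in\mathbb Z}\in\ell^\infty_{\beta,|\cdot|}$ such that $x_{n+1}-A_nx_n=y_{n+1}$ for all $n\in\mathbb Z$.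
   Context: $\mathbb N=\{0,1,2,\dots\}$. $(X,\|\cdot\|)$ is a Banach space and $\mathcal B(X)$ is the space of bounded linear operators on $X$ with the operator norm. A growth rate $\mu=(\mu_n)_{n\in\mathbb Z}$ is a strictly increasing sequence of positive numbers with $\lim_{n\to+\infty}\mu_n=+\infty$ and $\lim_{n\to-\infty}\mu_n=0$. For $m\ge n$, $\mathcal A(m,n)=A_{m-1}\cdots A_n$ if $m>n$ and $\mathcal A(n,n)=\mathrm{Id}$. $(\mu,\nu)$-dichotomy: $(A_n)_{n\in\mathbb Z}$ admits a $(\mu,\nu)$-dichotomy with respect to projections $P_n$ on $X$, $n\in\mathbb Z$, if (1) $A_nP_n=P_{n+1}A_n$ for all $n$; (2) $A_n|_{\operatorname{Ker}P_n}:\operatorname{Ker}P_n\to\operatorname{Ker}P_{n+1}$ is invertible for all $n$; (3) there exist $D,\lambda>0$ such that $\|\mathcal A(m,n)P_n\|\le D\nu_n(\mu_m/\mu_n)^{-\lambda}$ for $m\ge n$ and $\|\mathcal A(m,n)(\mathrm{Id}-P_n)\|\le D\nu_n(\mu_n/\mu_m)^{-\lambda}$ for $m\le n$, where for $m\le n$ one sets $\mathcal A(m,n):=(\mathcal A(n,m)|_{\operatorname{Ker}P_m})^{-1}:\operatorname{Ker}P_n\to\operatorname{Ker}P_m$. Weighted spaces: for $\beta\in\mathbb R$, $\ell^\infty_\beta$ is the Banach space of sequences $\mathbf x=(x_n)_{n\in\mathbb Z}\subset X$ with $\|\mathbf x\|_{\infty,\beta}:=\sup_{n\in\mathbb Z}\mu_n^\beta\|x_n\|<+\infty$,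 and $\ell^1_\beta$ is the Banach space of sequences with $\|\mathbf x\|_{1,\beta}:=\sum_{n\in\mathbb Z}\mu_n^\beta\nu_n\|x_n\|<+\infty$. Let $n_0\in\mathbb Z$ be the integer such that $\mu_n<1$ for $n<n_0$ and $\mu_n\ge1$ for $n\ge n_0$. Then $\ell^\infty_{\beta,|\cdot|}$ is the Banach space of sequences with $\|\mathbf x\|_{\infty,\beta,|\cdot|}:=\max\{\sup_{n<n_0}\mu_n^{|\beta|}\|x_n\|,\ \sup_{n\ge n_0}\mu_n^{-|\beta|}\|x_n\|\}<+\infty$, and $\ell^1_{\beta,|\cdot|}$ is the Banach space of sequences with $\|\mathbf x\|_{1,\beta,|\cdot|}:=\sum_{n<n_0}\mu_n^{|\beta|}\nu_n\|x_n\|+\sum_{n\ge n_0}\mu_n^{-|\beta|}\nu_n\|x_n\|<+\infty$. *)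

theory Defs
  imports "HOL-Analysis.Analysis"
begin

definition growth_rate :: "(int \<Rightarrow> real) \<Rightarrow> bool" where
  "growth_rate \<mu> \<longleftrightarrow>
     strict_mono \<mu> \<and> (\<forall>n. 0 < \<mu> n) \<and>
     filterlim \<mu> at_top at_top \<and> (\<mu> \<longlongrightarrow> 0) at_bot"

primrec evol_steps :: "(int \<Rightarrow> 'a::real_normed_vector \<Rightarrow>\<^sub>L 'a) \<Rightarrow> int \<Rightarrow> nat \<Rightarrow> 'a \<Rightarrow>\<^sub>L 'a" where
  "evol_steps A n 0 = id_blinfun"
| "evol_steps A n (Suc k) = A (n + int k) o\<^sub>L evol_steps A n k"

(* A_{m-1} ... A_n, to be used for m >= n only *)
definition fwd_evol :: "(int \<Rightarrow> 'a::real_normed_vector \<Rightarrow>\<^sub>L 'a) \<Rightarrow> int \<Rightarrow> int \<Rightarrow> 'a \<Rightarrow>\<^sub>L 'a" where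
  "fwd_evol A m n = evol_steps A n (nat (m - n))"

definition blinfun_ker :: "('a::real_normed_vector \<Rightarrow>\<^sub>L 'b::real_normed_vector) \<Rightarrow> 'a set" where
  "blinfun_ker T = {x. blinfun_apply T x = 0}"

(* the inverse Ker P_n -> Ker P_m of A_{n-1} ... A_m restricted to Ker P_m, to be used
   for m <= n and on arguments in Ker P_n only *)
definition bwd_evol ::
  "(int \<Rightarrow> 'a::real_normed_vector \<Rightarrow>\<^sub>L 'a) \<Rightarrow> (int \<Rightarrow> 'a \<Rightarrow>\<^sub>L 'a) \<Rightarrow> int \<Rightarrow> int \<Rightarrow> 'a \<Rightarrow> 'a" where
  "bwd_evol A P m n = inv_into (blinfun_ker (P m)) (blinfun_apply (fwd_evol A n m))"

(* onorm is meaningful only for bounded linear maps, hence the explicit conjunct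
   bounded_linear in the second estimate. On a Banach space it is no restriction: a bijective
   bounded operator between the closed subspaces Ker P_m and Ker P_n has a bounded inverse. *)
definition dichotomy_estimates ::
  "(int \<Rightarrow> real) \<Rightarrow> (int \<Rightarrow> real) \<Rightarrow> (int \<Rightarrow> 'a::real_normed_vector \<Rightarrow>\<^sub>L 'a) \<Rightarrow> (int \<Rightarrow> 'a \<Rightarrow>\<^sub>L 'a)
     \<Rightarrow> real \<Rightarrow> real \<Rightarrow> bool" where
  "dichotomy_estimates \<mu> \<nu> A P D lam \<longleftrightarrow>
     (\<forall>m n. n \<le> m \<longrightarrow>
        norm (fwd_evol A m n o\<^sub>L P n) \<le> D * \<nu> n * (\<mu> m / \<mu> n) powr (- lam)) \<and>
     (\<forall>m n. m \<le> n \<longrightarrow>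
        bounded_linear (\<lambda>x. bwd_evol A P m n (x - P n x)) \<and>
        onorm (\<lambda>x. bwd_evol A P m n (x - P n x)) \<le> D * \<nu> n * (\<mu> n / \<mu> m) powr (- lam))"

definition dichotomy ::
  "(int \<Rightarrow> real) \<Rightarrow> (int \<Rightarrow> real) \<Rightarrow> (int \<Rightarrow> 'a::real_normed_vector \<Rightarrow>\<^sub>L 'a) \<Rightarrow> (int \<Rightarrow> 'a \<Rightarrow>\<^sub>L 'a)
     \<Rightarrow> bool" where
  "dichotomy \<mu> \<nu> A P \<longleftrightarrow>
     (\<forall>n. P n o\<^sub>L P n = P n) \<and>
     (\<forall>n. A n o\<^sub>L P n = P (n + 1) o\<^sub>L A n) \<and>
     (\<forall>n. bij_betw (blinfun_apply (A n)) (blinfun_ker (P n)) (blinfun_ker (P (n + 1)))) \<and>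
     (\<exists>D>0. \<exists>lam>0. dichotomy_estimates \<mu> \<nu> A P D lam)"

definition linf :: "(int \<Rightarrow> real) \<Rightarrow> real \<Rightarrow> (int \<Rightarrow> 'a::real_normed_vector) set" where
  "linf \<mu> \<beta> = {x. bdd_above (range (\<lambda>n. \<mu> n powr \<beta> * norm (x n)))}"

definition l1 :: "(int \<Rightarrow> real) \<Rightarrow> (int \<Rightarrow> real) \<Rightarrow> real \<Rightarrow> (int \<Rightarrow> 'a::real_normed_vector) set" where
  "l1 \<mu> \<nu> \<beta> = {x. (\<lambda>n. \<mu> n powr \<beta> * \<nu> n * norm (x n)) summable_on UNIV}"

definition unit_index :: "(int \<Rightarrow> real) \<Rightarrow> int" where
  "unit_index \<mu> = (THE k. (\<forall>n<k. \<mu> n < 1) \<and> (\<forall>n\<ge>k. 1 \<le> \<mu> n))"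

lemma unit_index_ex1:
  assumes "growth_rate \<mu>"
  shows "\<exists>!k. (\<forall>n<k. \<mu> n < 1) \<and> (\<forall>n\<ge>k. 1 \<le> \<mu> n)"
proof -
  have mono: "\<mu> m \<le> \<mu> n" if "m \<le> n" for m n
    using assms that by (simp add: growth_rate_def strict_mono_less_eq)
  have "eventually (\<lambda>n. \<mu> n < 1) at_bot"
    using assms by (auto simp: growth_rate_def dest: order_tendstoD(2)[of _ _ _ 1])
  then obtain a where a: "\<mu> a < 1"
    by (auto simp: eventually_at_bot_linorder)
  have "eventually (\<lambda>n. 1 \<le> \<mu> n) at_top"
    using assms by (auto simp: growth_rate_def filterlim_at_top)
  then obtain b where b: "1 \<le> \<mu> b"
    by (auto simp: eventually_at_top_linorder)
  have ab: "a < n" if "1 \<le> \<mu> n" for n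
    using mono[of n a] a that by linarith
  define j where "j = (LEAST j::nat. 1 \<le> \<mu> (a + int j))"
  have "1 \<le> \<mu> (a + int (nat (b - a)))"
    using ab[OF b] b by simp
  then have j: "1 \<le> \<mu> (a + int j)"
    unfolding j_def by (rule LeastI)
  have below: "\<mu> n < 1" if "n < a + int j" for n
  proof (rule ccontr)
    assume "\<not> \<mu> n < 1"
    then have n: "1 \<le> \<mu> n" by simp
    then have "1 \<le> \<mu> (a + int (nat (n - a)))" using ab[OF n] by simp
    then have "j \<le> nat (n - a)" unfolding j_def by (rule Least_le)
    then show False using that ab[OF n] by linarith
  qed
  have above: "1 \<le> \<mu> n" if "a + int j \<le> n" for n
    using mono[OF that] j by linarith
  show ?thesis
  proof (rule ex1I[of _ "a + int j"])
    show "(\<forall>n<a + int j. \<mu> n < 1) \<and> (\<forall>n\<ge>a + int j. 1 \<le> \<mu> n)"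
      using below above by blast
  next
    fix k assume k: "(\<forall>n<k. \<mu> n < 1) \<and> (\<forall>n\<ge>k. 1 \<le> \<mu> n)"
    have "\<not> k < a + int j" using k below[of k] by (metis order_refl not_less)
    moreover have "\<not> a + int j < k" using k j by (metis not_less)
    ultimately show "k = a + int j" by linarith
  qed
qed

definition linf_abs :: "(int \<Rightarrow> real) \<Rightarrow> real \<Rightarrow> (int \<Rightarrow> 'a::real_normed_vector) set" where
  "linf_abs \<mu> \<beta> =
     {x. bdd_above ((\<lambda>n. \<mu> n powr \<bar>\<beta>\<bar> * norm (x n)) ` {..<unit_index \<mu>}) \<and>
         bdd_above ((\<lambda>n. \<mu> n powr (- \<bar>\<beta>\<bar>) * norm (x n)) ` {unit_index \<mu>..})}"

definition l1_abs :: "(int \<Rightarrow> real) \<Rightarrow> (int \<Rightarrow> real) \<Rightarrow> real \<Rightarrow> (int \<Rightarrow> 'a::real_normed_vector) set" where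
  "l1_abs \<mu> \<nu> \<beta> =
     {x. (\<lambda>n. \<mu> n powr \<bar>\<beta>\<bar> * \<nu> n * norm (x n)) summable_on {..<unit_index \<mu>} \<and>
         (\<lambda>n. \<mu> n powr (- \<bar>\<beta>\<bar>) * \<nu> n * norm (x n)) summable_on {unit_index \<mu>..}}"

end

theory Submission
  imports Defs
begin

text \<open>
  Both weights, \<open>\<mu>\<^sub>n\<^sup>\<beta>\<close> and the one with absolute values, are instances of a weight \<open>w\<close> such that
  \<open>w \<mu>\<^sup>-\<^sup>\<lambda>\<close> is decreasing and \<open>w \<mu>\<^sup>\<lambda>\<close> is increasing. For such a weight the Green operator
  \<open>G(n,k) = A(n,k) P\<^sub>k\<close> for \<open>k \<le> n\<close> and \<open>G(n,k) = - A(n,k) (Id - P\<^sub>k)\<close> for \<open>k > n\<close> satisfies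
  \<open>w\<^sub>n \<parallel>G(n,k)\<parallel> \<le> D \<nu>\<^sub>k w\<^sub>k\<close>, so that \<open>x\<^sub>n = \<Sum>\<^sub>k G(n,k) y\<^sub>k\<close> converges, is bounded with
  weight \<open>w\<close> and solves the equation. A bounded solution \<open>z\<close> of the homogeneous equation vanishes: its
  component \<open>P\<^sub>n z\<^sub>n = A(n,m) P\<^sub>m z\<^sub>m\<close> is estimated by letting \<open>m \<rightarrow> -\<infinity>\<close>, and
  \<open>(Id - P\<^sub>n) z\<^sub>n = A(n,m) (Id - P\<^sub>m) z\<^sub>m\<close> by letting \<open>m \<rightarrow> +\<infinity>\<close>; the growth condition on
  \<open>\<nu>\<close> makes both bounds tend to zero.
\<close>

section \<open>Products of the operators \<open>A n\<close> over an interval of times\<close>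

text \<open>The recursion of \<open>evol_steps\<close> appends the latest factor on the left; this
  splits off the earliest one on the right, which is what moving the initial time requires.\<close>

lemma evol_steps_Suc_shift:
  "evol_steps A n (Suc k) = evol_steps A (n + 1) k o\<^sub>L A n"
proof (induction k)
  case 0
  show ?case by (rule blinfun_eqI) simp
next
  case (Suc k)
  have "evol_steps A n (Suc (Suc k)) = A (n + int (Suc k)) o\<^sub>L (evol_steps A (n + 1) k o\<^sub>L A n)"
    using Suc.IH by simp
  also have "\<dots> = evol_steps A (n + 1) (Suc k) o\<^sub>L A n"
    by (rule blinfun_eqI) (simp add: algebra_simps)
  finally show ?case .
qed

lemma fwd_evol_refl [simp]: "fwd_evol A n n = id_blinfun"
  by (simp add: fwd_evol_def)

lemma fwd_evol_Suc:
  assumes "n \<le> m"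
  shows "fwd_evol A (m + 1) n = A m o\<^sub>L fwd_evol A m n"
proof -
  have "nat (m + 1 - n) = Suc (nat (m - n))" using assms by simp
  then show ?thesis using assms by (simp add: fwd_evol_def)
qed

lemma fwd_evol_Suc_shift:
  assumes "n < m"
  shows "fwd_evol A m n = fwd_evol A m (n + 1) o\<^sub>L A n"
proof -
  have "nat (m - n) = Suc (nat (m - (n + 1)))" using assms by simp
  then show ?thesis by (simp add: fwd_evol_def evol_steps_Suc_shift del: evol_steps.simps)
qed

section \<open>Evolution along the kernels and the Green operator\<close>

locale dichotomous_system =
  fixes A P :: "int \<Rightarrow> 'a::banach \<Rightarrow>\<^sub>L 'a"
    and \<mu> \<nu> :: "int \<Rightarrow> real" and D lam :: real
  assumes mu_pos: "0 < \<mu> n"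
    and nu_pos: "0 < \<nu> n"
    and D_pos: "0 < D"
    and proj: "P n o\<^sub>L P n = P n"
    and comm: "A n o\<^sub>L P n = P (n + 1) o\<^sub>L A n"
    and bij: "bij_betw (blinfun_apply (A n)) (blinfun_ker (P n)) (blinfun_ker (P (n + 1)))"
    and estimates: "dichotomy_estimates \<mu> \<nu> A P D lam"
begin

lemma proj_apply [simp]: "P n (P n x) = P n x"
  using arg_cong[OF proj[of n], of "\<lambda>T. blinfun_apply T x"] by simp

lemma comm_apply: "P (n + 1) (A n x) = A n (P n x)"
  using arg_cong[OF comm[of n], of "\<lambda>T. blinfun_apply T x"] by simp

lemma diff_proj_in_ker: "x - P n x \<in> blinfun_ker (P n)"
  by (simp add: blinfun_ker_def blinfun.bilinear_simps)

lemma fwd_evol_comm: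
  assumes "n \<le> m"
  shows "P m (fwd_evol A m n x) = fwd_evol A m n (P n x)"
  using assms
proof (induction m rule: int_ge_induct)
  case base
  show ?case by simp
next
  case (step m)
  then show ?case by (simp add: fwd_evol_Suc comm_apply)
qed

text \<open>Composition of the one-step bijections \<open>bij\<close>. It turns the
  \<open>inv_into\<close> behind \<open>bwd_evol\<close> into a genuine inverse between the
  kernels.\<close>

lemma bij_betw_fwd_evol:
  assumes "n \<le> m"
  shows "bij_betw (blinfun_apply (fwd_evol A m n)) (blinfun_ker (P n)) (blinfun_ker (P m))"
  using assms
proof (induction m rule: int_ge_induct)
  case base
  show ?case by (simp add: bij_betw_def inj_on_def)
next
  case (step m)
  have "blinfun_apply (fwd_evol A (m + 1) n) = blinfun_apply (A m) \<circ> blinfun_apply (fwd_evol A m n)"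
    using step by (auto simp: fwd_evol_Suc)
  then show ?case using bij_betw_trans[OF step.IH bij] by (simp only:)
qed

lemma bwd_evol_in_ker:
  assumes "m \<le> n" "x \<in> blinfun_ker (P n)"
  shows "bwd_evol A P m n x \<in> blinfun_ker (P m)"
  unfolding bwd_evol_def
  by (rule inv_into_into) (use bij_betw_imp_surj_on[OF bij_betw_fwd_evol[OF assms(1)]] assms(2) in simp)

lemma fwd_evol_bwd_evol:
  assumes "m \<le> n" "x \<in> blinfun_ker (P n)"
  shows "fwd_evol A n m (bwd_evol A P m n x) = x"
  unfolding bwd_evol_def
  using bij_betw_fwd_evol[OF assms(1)] assms(2) by (rule bij_betw_inv_into_right)

lemma bwd_evol_fwd_evol:
  assumes "m \<le> n" "x \<in> blinfun_ker (P m)"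
  shows "bwd_evol A P m n (fwd_evol A n m x) = x"
  unfolding bwd_evol_def
  using bij_betw_fwd_evol[OF assms(1)] assms(2) by (rule bij_betw_inv_into_left)

text \<open>Both sides lie in \<open>blinfun_ker (P (m + 1))\<close> and reach \<open>x\<close> at
  time \<open>n\<close>; forward evolution is injective on that kernel.\<close>

lemma bwd_evol_step:
  assumes "m < n" "x \<in> blinfun_ker (P n)"
  shows "A m (bwd_evol A P m n x) = bwd_evol A P (m + 1) n x"
proof -
  let ?u = "A m (bwd_evol A P m n x)"
  have "?u \<in> blinfun_ker (P (m + 1))"
    using bwd_evol_in_ker[of m n x] bij[of m] assms by (auto simp: bij_betw_def)
  moreover have "fwd_evol A n (m + 1) ?u = x"
    using fwd_evol_bwd_evol[of m n x] assms by (simp add: fwd_evol_Suc_shift)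
  ultimately show ?thesis
    using bwd_evol_fwd_evol[of "m + 1" n ?u] assms(1) by simp
qed

definition green :: "int \<Rightarrow> int \<Rightarrow> 'a \<Rightarrow> 'a" where
  "green n k x = (if k \<le> n then fwd_evol A n k (P k x) else - bwd_evol A P n k (x - P k x))"

text \<open>As a function of \<open>n\<close>, the Green operator follows the homogeneous equation
  on each branch. The branches change between \<open>n = k - 1\<close> and \<open>n = k\<close>,
  where the jump is \<open>P k x + (x - P k x) = x\<close>.\<close>

lemma green_step:
  "green (n + 1) k x = A n (green n k x) + (if k = n + 1 then x else 0)"
proof -
  consider "k \<le> n" | "k = n + 1" | "n + 1 < k" by linarith
  then show ?thesis
  proof cases
    case 1
    then show ?thesis by (simp add: green_def fwd_evol_Suc)
  next
    case 2
    \<comment> \<open>One step forward leads to \<open>bwd_evol A P (n + 1) (n + 1)\<close>, the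
      identity on its kernel.\<close>
    have "A n (bwd_evol A P n (n + 1) (x - P (n + 1) x)) = x - P (n + 1) x"
      using bwd_evol_fwd_evol[of "n + 1" "n + 1" "x - P (n + 1) x"] bwd_evol_step[of n "n + 1"]
        diff_proj_in_ker[of x "n + 1"] by simp
    then show ?thesis using 2 by (simp add: green_def blinfun.bilinear_simps)
  next
    case 3
    then show ?thesis
      using bwd_evol_step[of n k "x - P k x"] diff_proj_in_ker[of x k]
      by (simp add: green_def blinfun.bilinear_simps)
  qed
qed

section \<open>Dichotomy estimates on vectors\<close>

lemma fwd_bound:
  assumes "n \<le> m"
  shows "norm (fwd_evol A m n (P n x)) \<le> D * \<nu> n * (\<mu> m / \<mu> n) powr (- lam) * norm x"
proof -
  have "norm (fwd_evol A m n (P n x)) \<le> norm (fwd_evol A m n o\<^sub>L P n) * norm x"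
    by (metis norm_blinfun blinfun_apply_blinfun_compose)
  also have "\<dots> \<le> D * \<nu> n * (\<mu> m / \<mu> n) powr (- lam) * norm x"
    using estimates assms by (intro mult_right_mono) (auto simp: dichotomy_estimates_def)
  finally show ?thesis .
qed

lemma bwd_bound:
  assumes "m \<le> n"
  shows "norm (bwd_evol A P m n (x - P n x)) \<le> D * \<nu> n * (\<mu> n / \<mu> m) powr (- lam) * norm x"
proof -
  let ?f = "\<lambda>x. bwd_evol A P m n (x - P n x)"
  have "bounded_linear ?f" and le: "onorm ?f \<le> D * \<nu> n * (\<mu> n / \<mu> m) powr (- lam)"
    using estimates assms by (auto simp: dichotomy_estimates_def)
  \<comment> \<open>Bounded linearity of \<open>?f\<close> is what makes \<open>onorm\<close> a
    bound on its values.\<close>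
  then have "norm (?f x) \<le> onorm ?f * norm x" by (intro onorm)
  also have "\<dots> \<le> D * \<nu> n * (\<mu> n / \<mu> m) powr (- lam) * norm x"
    using le by (intro mult_right_mono) auto
  finally show ?thesis .
qed

end

section \<open>Existence and uniqueness for an abstract weight\<close>

text \<open>The monotonicity conditions \<open>w_fwd\<close> and \<open>w_bwd\<close>, written with
  the ratios of the dichotomy estimates, serve existence; the two limits serve uniqueness.\<close>

locale admissible_weight = dichotomous_system +
  fixes w :: "int \<Rightarrow> real"
  assumes w_pos: "0 < w n"
    and w_fwd: "n \<le> m \<Longrightarrow> w m * (\<mu> m / \<mu> n) powr (- lam) \<le> w n"
    and w_bwd: "m \<le> n \<Longrightarrow> w m * (\<mu> n / \<mu> m) powr (- lam) \<le> w n"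
    and lim_bot: "((\<lambda>m. \<nu> m * \<mu> m powr lam / w m) \<longlongrightarrow> 0) at_bot"
    and lim_top: "((\<lambda>m. \<nu> m * \<mu> m powr (- lam) / w m) \<longlongrightarrow> 0) at_top"
begin

text \<open>On either branch \<open>w n\<close> absorbs the dichotomy factor \<open>r\<close> and
  becomes \<open>w k\<close>, so the bound is uniform in \<open>n\<close>.\<close>

lemma green_bound: "w n * norm (green n k x) \<le> D * (w k * \<nu> k * norm x)"
proof -
  define r where "r = (if k \<le> n then \<mu> n / \<mu> k else \<mu> k / \<mu> n) powr (- lam)"
  have "norm (green n k x) \<le> D * \<nu> k * r * norm x"
    using fwd_bound[of k n x] bwd_bound[of n k x] by (auto simp: green_def r_def)
  then have "w n * norm (green n k x) \<le> w n * (D * \<nu> k * r * norm x)"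
    using w_pos[of n] by (intro mult_left_mono) auto
  also have "\<dots> = (w n * r) * (D * \<nu> k * norm x)" by (simp add: algebra_simps)
  also have "\<dots> \<le> w k * (D * \<nu> k * norm x)"
    using w_fwd[of k n] w_bwd[of n k] D_pos nu_pos[of k]
    by (intro mult_right_mono) (auto simp: r_def)
  finally show ?thesis by (simp add: algebra_simps)
qed

lemma bounded_solution_exists:
  assumes y: "(\<lambda>n. w n * \<nu> n * norm (y n)) summable_on UNIV"
  shows "\<exists>x. bdd_above (range (\<lambda>n. w n * norm (x n))) \<and> (\<forall>n. x (n + 1) - A n (x n) = y (n + 1))"
proof -
  let ?s = "\<lambda>k. w k * \<nu> k * norm (y k)"
  define x where "x n = (\<Sum>\<^sub>\<infinity>k. green n k (y k))" for n
  \<comment> \<open>For fixed \<open>n\<close> this gives absolute convergence; multiplying back by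
    \<open>w n\<close> later leaves a bound free of \<open>n\<close>.\<close>
  have dom: "norm (green n k (y k)) \<le> D / w n * ?s k" for n k
    using green_bound[of n k "y k"] w_pos[of n] by (simp add: field_simps)
  have dom_summable: "(\<lambda>k. D / w n * ?s k) summable_on UNIV" for n
    using y by (rule summable_on_cmult_right)
  have nsum: "(\<lambda>k. norm (green n k (y k))) summable_on UNIV" for n
    using dom_summable dom by (rule summable_on_comparison_test) auto
  then have gsum: "(\<lambda>k. green n k (y k)) summable_on UNIV" for n
    by (rule abs_summable_summable)
  have "w n * norm (x n) \<le> D * infsum ?s UNIV" for n
  proof -
    have "norm (x n) \<le> (\<Sum>\<^sub>\<infinity>k. norm (green n k (y k)))"
      unfolding x_def using nsum by (rule norm_infsum_bound)
    also have "\<dots> \<le> (\<Sum>\<^sub>\<infinity>k. D / w n * ?s k)"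
      using nsum dom_summable dom by (rule infsum_mono)
    also have "\<dots> = D / w n * infsum ?s UNIV"
      using y by (intro infsum_cmult_right)
    finally show ?thesis using w_pos[of n] by (simp add: field_simps)
  qed
  then have bdd: "bdd_above (range (\<lambda>n. w n * norm (x n)))" by (rule bdd_aboveI2)
  have "x (n + 1) - A n (x n) = y (n + 1)" for n
  proof -
    \<comment> \<open>Continuity of \<open>A n\<close> lets it pass through the series; the jumps in
      \<open>green_step\<close> then add the single term \<open>y (n + 1)\<close>.\<close>
    have "((\<lambda>k. A n (green n k (y k))) has_sum A n (x n)) UNIV"
      unfolding x_def using gsum
      by (intro has_sum_bounded_linear[OF blinfun.bounded_linear_right] has_sum_infsum)
    moreover have "((\<lambda>k. if k = n + 1 then y k else 0) has_sum y (n + 1)) UNIV"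
      by (rule has_sum_finite_neutralI[of "{n + 1}"]) auto
    ultimately have "((\<lambda>k. green (n + 1) k (y k)) has_sum (A n (x n) + y (n + 1))) UNIV"
      unfolding green_step by (rule has_sum_add)
    then show ?thesis by (simp add: x_def infsumI)
  qed
  with bdd show ?thesis by blast
qed

lemma homogeneous_bounded_solution_zero:
  assumes bdd: "\<And>n. w n * norm (z n) \<le> M" and z: "\<And>n. z (n + 1) = A n (z n)"
  shows "z n = 0"
proof -
  have zm: "norm (z m) \<le> M / w m" for m
    using bdd[of m] w_pos[of m] by (simp add: field_simps)
  have zfwd: "z m = fwd_evol A m k (z k)" if "k \<le> m" for k m
    using that
  proof (induction m rule: int_ge_induct)
    case base
    show ?case by simp
  next
    case (step m)
    then show ?case by (simp add: z fwd_evol_Suc)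
  qed
  have P0: "P n (z n) = 0"
  proof -
    \<comment> \<open>\<open>c\<close> collects the factors independent of \<open>m\<close> once
      \<open>norm (z m)\<close> is replaced by \<open>M / w m\<close>.\<close>
    define c where "c = D * \<mu> n powr (- lam) * M"
    have bound: "norm (P n (z n)) \<le> c * (\<nu> m * \<mu> m powr lam / w m)" if "m \<le> n" for m
    proof -
      have "norm (P n (z n)) \<le> D * \<nu> m * (\<mu> n / \<mu> m) powr (- lam) * norm (z m)"
        using fwd_bound[OF that, of "z m"] zfwd[OF that] fwd_evol_comm[OF that, of "z m"] by simp
      also have "\<dots> \<le> D * \<nu> m * (\<mu> n / \<mu> m) powr (- lam) * (M / w m)"
        using D_pos nu_pos[of m] zm by (intro mult_left_mono) auto
      also have "\<dots> = c * (\<nu> m * \<mu> m powr lam / w m)"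
        using mu_pos[of n] mu_pos[of m]
        by (simp add: c_def powr_divide powr_minus field_simps)
      finally show ?thesis .
    qed
    have "((\<lambda>m. c * (\<nu> m * \<mu> m powr lam / w m)) \<longlongrightarrow> 0) at_bot"
      using tendsto_mult_left[OF lim_bot, of c] by simp
    then have "norm (P n (z n)) \<le> 0"
      by (rule tendsto_lowerbound)
        (use bound in \<open>auto simp: eventually_at_bot_linorder\<close>)
    then show ?thesis by simp
  qed
  have Q0: "z n - P n (z n) = 0"
  proof -
    define c where "c = D * \<mu> n powr lam * M"
    have bound: "norm (z n - P n (z n)) \<le> c * (\<nu> m * \<mu> m powr (- lam) / w m)" if "n \<le> m" for m
    proof -
      \<comment> \<open>The kernel component also evolves forward, so injectivity there recovers its
        value at \<open>n\<close> from the later time \<open>m\<close>.\<close>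
      have "z m - P m (z m) = fwd_evol A m n (z n - P n (z n))"
        using zfwd[OF that] fwd_evol_comm[OF that, of "z n"] by (simp add: blinfun.bilinear_simps)
      then have "bwd_evol A P n m (z m - P m (z m)) = z n - P n (z n)"
        using bwd_evol_fwd_evol[OF that diff_proj_in_ker] by simp
      then have "norm (z n - P n (z n)) \<le> D * \<nu> m * (\<mu> m / \<mu> n) powr (- lam) * norm (z m)"
        using bwd_bound[OF that, of "z m"] by simp
      also have "\<dots> \<le> D * \<nu> m * (\<mu> m / \<mu> n) powr (- lam) * (M / w m)"
        using D_pos nu_pos[of m] zm by (intro mult_left_mono) auto
      also have "\<dots> = c * (\<nu> m * \<mu> m powr (- lam) / w m)"
        using mu_pos[of n] mu_pos[of m]
        by (simp add: c_def powr_divide powr_minus field_simps)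
      finally show ?thesis .
    qed
    have "((\<lambda>m. c * (\<nu> m * \<mu> m powr (- lam) / w m)) \<longlongrightarrow> 0) at_top"
      using tendsto_mult_left[OF lim_top, of c] by simp
    then have "norm (z n - P n (z n)) \<le> 0"
      by (rule tendsto_lowerbound)
        (use bound in \<open>auto simp: eventually_at_top_linorder\<close>)
    then show ?thesis by simp
  qed
  show ?thesis using P0 Q0 by simp
qed

text \<open>Uniqueness: the difference of two solutions solves the homogeneous equation and is
  bounded in the weight \<open>w\<close>.\<close>

theorem ex1_bounded_solution:
  assumes "(\<lambda>n. w n * \<nu> n * norm (y n)) summable_on UNIV"
  shows "\<exists>!x. bdd_above (range (\<lambda>n. w n * norm (x n))) \<and> (\<forall>n. x (n + 1) - A n (x n) = y (n + 1))"
proof (rule ex_ex1I[OF bounded_solution_exists[OF assms]])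
  fix x x'
  assume x: "bdd_above (range (\<lambda>n. w n * norm (x n))) \<and> (\<forall>n. x (n + 1) - A n (x n) = y (n + 1))"
    and x': "bdd_above (range (\<lambda>n. w n * norm (x' n))) \<and> (\<forall>n. x' (n + 1) - A n (x' n) = y (n + 1))"
  obtain M M' where M: "\<And>n. w n * norm (x n) \<le> M" and M': "\<And>n. w n * norm (x' n) \<le> M'"
    using x x' by (auto simp: bdd_above_def)
  define z where "z n = x n - x' n" for n
  have bdd: "w n * norm (z n) \<le> M + M'" for n
  proof -
    have "w n * norm (z n) \<le> w n * (norm (x n) + norm (x' n))"
      unfolding z_def using w_pos[of n] by (intro mult_left_mono norm_triangle_ineq4) auto
    then show ?thesis using M[of n] M'[of n] by (simp add: algebra_simps)
  qed
  have "x (n + 1) = y (n + 1) + A n (x n)" "x' (n + 1) = y (n + 1) + A n (x' n)" for n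
    using x x' by (simp_all add: diff_eq_eq)
  then have "z (n + 1) = A n (z n)" for n
    by (simp add: z_def blinfun.bilinear_simps)
  from homogeneous_bounded_solution_zero[of z, OF bdd this] show "x = x'"
    by (auto simp: z_def)
qed

end

section \<open>Powers of the growth rate as weights\<close>

text \<open>These are rearrangements of the monotonicity of \<open>t powr (lam - \<beta>)\<close>
  and \<open>t powr (lam + \<beta>)\<close>, whose exponents are nonnegative.\<close>

lemma powr_ratio_mono:
  fixes a b :: real
  assumes "0 < a" "a \<le> b" "-lam \<le> \<beta>" "\<beta> \<le> lam"
  shows "b powr \<beta> * (b / a) powr (- lam) \<le> a powr \<beta>"
    and "a powr \<beta> * (b / a) powr (- lam) \<le> b powr \<beta>"
proof -
  have b: "0 < b" using assms by linarith
  have "a powr (lam - \<beta>) \<le> b powr (lam - \<beta>)"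
    using assms by (intro powr_mono2) auto
  then show "b powr \<beta> * (b / a) powr (- lam) \<le> a powr \<beta>"
    using assms b by (simp add: powr_divide powr_minus powr_diff field_simps)
  have "a powr (lam + \<beta>) \<le> b powr (lam + \<beta>)"
    using assms by (intro powr_mono2) auto
  then show "a powr \<beta> * (b / a) powr (- lam) \<le> b powr \<beta>"
    using assms b by (simp add: powr_divide powr_minus powr_add field_simps)
qed

text \<open>Splitting off \<open>\<mu> m powr \<epsilon>\<close> to bound \<open>\<nu> m\<close>
  leaves the positive exponent \<open>lam - \<epsilon> - \<beta>\<close> on a base tending to
  0.\<close>

lemma growth_limit_at_bot:
  assumes mu: "growth_rate \<mu>" and nu: "\<And>n. 1 \<le> \<nu> n"
    and bdd: "bdd_above (range (\<lambda>n::nat. \<mu> (- int n) powr \<epsilon> * \<nu> (- int n)))"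
    and \<beta>: "\<beta> < lam - \<epsilon>"
  shows "((\<lambda>m. \<nu> m * \<mu> m powr lam / \<mu> m powr \<beta>) \<longlongrightarrow> 0) at_bot"
proof -
  have pos: "0 < \<mu> n" for n using mu by (simp add: growth_rate_def)
  obtain C where C: "\<And>n. \<mu> (- int n) powr \<epsilon> * \<nu> (- int n) \<le> C"
    using bdd by (auto simp: bdd_above_def)
  have bound: "\<nu> m * \<mu> m powr lam / \<mu> m powr \<beta> \<le> C * \<mu> m powr (lam - \<epsilon> - \<beta>)" if "m \<le> 0" for m
  proof -
    have "\<nu> m * \<mu> m powr lam / \<mu> m powr \<beta> = \<mu> m powr \<epsilon> * \<nu> m * \<mu> m powr (lam - \<epsilon> - \<beta>)"
      using pos[of m] by (simp add: powr_diff)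
    also have "\<dots> \<le> C * \<mu> m powr (lam - \<epsilon> - \<beta>)"
      using C[of "nat (- m)"] that by (intro mult_right_mono) auto
    finally show ?thesis .
  qed
  have "((\<lambda>m. \<mu> m powr (lam - \<epsilon> - \<beta>)) \<longlongrightarrow> 0) at_bot"
    using mu \<beta> pos by (intro tendsto_zero_powrI[where b = "lam - \<epsilon> - \<beta>"])
      (auto simp: growth_rate_def less_imp_le)
  then have lim: "((\<lambda>m. C * \<mu> m powr (lam - \<epsilon> - \<beta>)) \<longlongrightarrow> 0) at_bot"
    by (rule tendsto_mult_right_zero)
  have nonneg: "0 \<le> \<nu> m * \<mu> m powr lam / \<mu> m powr \<beta>" for m
    using nu[of m] by simp
  show ?thesis
    by (rule tendsto_sandwich[OF _ _ tendsto_const lim])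
      (use nonneg bound in \<open>auto simp: eventually_at_bot_linorder\<close>)
qed

text \<open>Here \<open>\<mu> m powr (- \<epsilon>)\<close> bounds \<open>\<nu> m\<close>, and the
  remaining exponent \<open>\<epsilon> - lam - \<beta>\<close> is negative on a base tending to
  infinity.\<close>

lemma growth_limit_at_top:
  assumes mu: "growth_rate \<mu>" and nu: "\<And>n. 1 \<le> \<nu> n"
    and bdd: "bdd_above (range (\<lambda>n::nat. \<mu> (int n) powr (- \<epsilon>) * \<nu> (int n)))"
    and \<beta>: "- (lam - \<epsilon>) < \<beta>"
  shows "((\<lambda>m. \<nu> m * \<mu> m powr (- lam) / \<mu> m powr \<beta>) \<longlongrightarrow> 0) at_top"
proof -
  have pos: "0 < \<mu> n" for n using mu by (simp add: growth_rate_def)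
  obtain C where C: "\<And>n. \<mu> (int n) powr (- \<epsilon>) * \<nu> (int n) \<le> C"
    using bdd by (auto simp: bdd_above_def)
  have bound: "\<nu> m * \<mu> m powr (- lam) / \<mu> m powr \<beta> \<le> C * \<mu> m powr (\<epsilon> - lam - \<beta>)" if "0 \<le> m" for m
  proof -
    have "\<nu> m * \<mu> m powr (- lam) / \<mu> m powr \<beta> = \<mu> m powr (- \<epsilon>) * \<nu> m * \<mu> m powr (\<epsilon> - lam - \<beta>)"
      using pos[of m] by (simp add: powr_diff powr_minus powr_add field_simps)
    also have "\<dots> \<le> C * \<mu> m powr (\<epsilon> - lam - \<beta>)"
      using C[of "nat m"] that by (intro mult_right_mono) auto
    finally show ?thesis .
  qed
  have "((\<lambda>m. \<mu> m powr (\<epsilon> - lam - \<beta>)) \<longlongrightarrow> 0) at_top"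
    using mu \<beta> by (intro tendsto_neg_powr) (auto simp: growth_rate_def)
  then have lim: "((\<lambda>m. C * \<mu> m powr (\<epsilon> - lam - \<beta>)) \<longlongrightarrow> 0) at_top"
    by (rule tendsto_mult_right_zero)
  have nonneg: "0 \<le> \<nu> m * \<mu> m powr (- lam) / \<mu> m powr \<beta>" for m
    using nu[of m] by simp
  show ?thesis
    by (rule tendsto_sandwich[OF _ _ tendsto_const lim])
      (use nonneg bound in \<open>auto simp: eventually_at_top_linorder\<close>)
qed

section \<open>The weight with absolute values\<close>

definition abs_weight :: "(int \<Rightarrow> real) \<Rightarrow> real \<Rightarrow> int \<Rightarrow> real" where
  "abs_weight \<mu> \<beta> n = (if n < unit_index \<mu> then \<mu> n powr \<bar>\<beta>\<bar> else \<mu> n powr (- \<bar>\<beta>\<bar>))"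

lemma unit_index_props:
  assumes "growth_rate \<mu>"
  shows "n < unit_index \<mu> \<Longrightarrow> \<mu> n < 1" "unit_index \<mu> \<le> n \<Longrightarrow> 1 \<le> \<mu> n"
  using theI'[OF unit_index_ex1[OF assms], folded unit_index_def] by blast+

text \<open>The sign of \<open>\<mu> n - 1\<close> decides which power is smaller. As a minimum, the
  weight inherits the ratio inequalities from both powers, with no cases on the position of the two
  indices relative to \<open>unit_index \<mu>\<close>.\<close>

lemma abs_weight_eq_min:
  assumes "growth_rate \<mu>"
  shows "abs_weight \<mu> \<beta> n = min (\<mu> n powr \<bar>\<beta>\<bar>) (\<mu> n powr (- \<bar>\<beta>\<bar>))"
proof -
  have pos: "0 < \<mu> n" using assms by (simp add: growth_rate_def)
  show ?thesis
  proof (cases "n < unit_index \<mu>")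
    case True
    then have "\<mu> n powr \<bar>\<beta>\<bar> \<le> \<mu> n powr (- \<bar>\<beta>\<bar>)"
      using unit_index_props(1)[OF assms True] pos by (intro powr_mono') auto
    with True show ?thesis by (simp add: abs_weight_def)
  next
    case False
    then have "\<mu> n powr (- \<bar>\<beta>\<bar>) \<le> \<mu> n powr \<bar>\<beta>\<bar>"
      using unit_index_props(2)[OF assms, of n] by (intro powr_mono) auto
    with False show ?thesis by (simp add: abs_weight_def)
  qed
qed

lemma linf_abs_iff:
  "x \<in> linf_abs \<mu> \<beta> \<longleftrightarrow> bdd_above (range (\<lambda>n. abs_weight \<mu> \<beta> n * norm (x n)))"
proof -
  have "range (\<lambda>n. abs_weight \<mu> \<beta> n * norm (x n)) =
      (\<lambda>n. \<mu> n powr \<bar>\<beta>\<bar> * norm (x n)) ` {..<unit_index \<mu>} \<union>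
      (\<lambda>n. \<mu> n powr (- \<bar>\<beta>\<bar>) * norm (x n)) ` {unit_index \<mu>..}"
    (is "range ?f = ?U \<union> ?V")
  proof -
    have "?U = ?f ` {..<unit_index \<mu>}" "?V = ?f ` {unit_index \<mu>..}"
      by (intro image_cong; simp add: abs_weight_def)+
    moreover have "UNIV = {..<unit_index \<mu>} \<union> {unit_index \<mu>..}" by auto
    ultimately show ?thesis by (metis image_Un)
  qed
  then show ?thesis by (simp add: linf_abs_def)
qed

lemma l1_abs_summable:
  assumes "y \<in> l1_abs \<mu> \<nu> \<beta>"
  shows "(\<lambda>n. abs_weight \<mu> \<beta> n * \<nu> n * norm (y n)) summable_on UNIV" (is "?f summable_on _")
proof -
  have "?f summable_on {..<unit_index \<mu>}"
    using assms unfolding l1_abs_def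
    by (subst summable_on_cong[where g = "\<lambda>n. \<mu> n powr \<bar>\<beta>\<bar> * \<nu> n * norm (y n)"])
      (auto simp: abs_weight_def)
  moreover have "?f summable_on {unit_index \<mu>..}"
    using assms unfolding l1_abs_def
    by (subst summable_on_cong[where g = "\<lambda>n. \<mu> n powr (- \<bar>\<beta>\<bar>) * \<nu> n * norm (y n)"])
      (auto simp: abs_weight_def)
  ultimately have "?f summable_on ({..<unit_index \<mu>} \<union> {unit_index \<mu>..})"
    by (rule summable_on_Un_disjoint) auto
  moreover have "{..<unit_index \<mu>} \<union> {unit_index \<mu>..} = UNIV" by auto
  ultimately show ?thesis by simp
qed

theorem theorem4p1:
  fixes A P :: "int \<Rightarrow> 'a::banach \<Rightarrow>\<^sub>L 'a"
    and \<mu> \<nu> :: "int \<Rightarrow> real"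
    and D lam \<epsilon> \<beta> :: real
  assumes "growth_rate \<mu>"
    and "\<And>n. 1 \<le> \<nu> n"
    and "dichotomy \<mu> \<nu> A P"
    and "0 < D" and "0 < lam"
    and "dichotomy_estimates \<mu> \<nu> A P D lam"
    and "0 \<le> \<epsilon>" and "\<epsilon> < lam"
    and "bdd_above (range (\<lambda>n::nat. \<mu> (- int n) powr \<epsilon> * \<nu> (- int n)))"
    and "bdd_above (range (\<lambda>n::nat. \<mu> (int n) powr (- \<epsilon>) * \<nu> (int n)))"
    and "- (lam - \<epsilon>) < \<beta>" and "\<beta> < lam - \<epsilon>"
  shows "(\<forall>y \<in> l1 \<mu> \<nu> \<beta>. \<exists>!x. x \<in> linf \<mu> \<beta> \<and> (\<forall>n. x (n + 1) - A n (x n) = y (n + 1))) \<and>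
         (\<forall>y \<in> l1_abs \<mu> \<nu> \<beta>. \<exists>!x. x \<in> linf_abs \<mu> \<beta> \<and> (\<forall>n. x (n + 1) - A n (x n) = y (n + 1)))"
proof -
  have pos: "0 < \<mu> n" for n using assms(1) by (simp add: growth_rate_def)
  have mono: "\<mu> m \<le> \<mu> n" if "m \<le> n" for m n
    using assms(1) that by (simp add: growth_rate_def strict_mono_less_eq)
  have nu_pos: "0 < \<nu> n" for n using assms(2)[of n] by linarith
  \<comment> \<open>The exponent stays schematic, so that both limits apply to
    \<open>\<beta>\<close> as well as to \<open>\<bar>\<beta>\<bar>\<close> at the bottom and its
    negative at the top.\<close>
  note lim_bot = growth_limit_at_bot[OF assms(1,2,9)]
    and lim_top = growth_limit_at_top[OF assms(1,2,10)]
  interpret dichotomous_system A P \<mu> \<nu> D lam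
    using assms(3,4,6) pos nu_pos by unfold_locales (auto simp: dichotomy_def)
  interpret std: admissible_weight A P \<mu> \<nu> D lam "\<lambda>n. \<mu> n powr \<beta>"
  proof unfold_locales
    show "0 < \<mu> n powr \<beta>" for n using pos[of n] by simp
    show "\<mu> m powr \<beta> * (\<mu> m / \<mu> n) powr (- lam) \<le> \<mu> n powr \<beta>" if "n \<le> m" for n m
      using powr_ratio_mono(1)[OF pos mono[OF that]] assms by simp
    show "\<mu> m powr \<beta> * (\<mu> n / \<mu> m) powr (- lam) \<le> \<mu> n powr \<beta>" if "m \<le> n" for n m
      using powr_ratio_mono(2)[OF pos mono[OF that]] assms by simp
  qed (use lim_bot lim_top assms in auto)
  interpret abs: admissible_weight A P \<mu> \<nu> D lam "abs_weight \<mu> \<beta>"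
  proof unfold_locales
    have \<beta>: "- lam \<le> \<bar>\<beta>\<bar>" "\<bar>\<beta>\<bar> \<le> lam" "- lam \<le> - \<bar>\<beta>\<bar>" "- \<bar>\<beta>\<bar> \<le> lam"
      using assms by auto
    note w = abs_weight_eq_min[OF assms(1)]
    show "0 < abs_weight \<mu> \<beta> n" for n using pos[of n] by (simp add: abs_weight_def)
    show "abs_weight \<mu> \<beta> m * (\<mu> m / \<mu> n) powr (- lam) \<le> abs_weight \<mu> \<beta> n" if "n \<le> m" for n m
      using powr_ratio_mono(1)[OF pos mono[OF that] \<beta>(1,2)]
        powr_ratio_mono(1)[OF pos mono[OF that] \<beta>(3,4)]
      unfolding w by (simp add: min_mult_distrib_right min_le_iff_disj)
    show "abs_weight \<mu> \<beta> m * (\<mu> n / \<mu> m) powr (- lam) \<le> abs_weight \<mu> \<beta> n" if "m \<le> n" for n m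
      using powr_ratio_mono(2)[OF pos mono[OF that] \<beta>(1,2)]
        powr_ratio_mono(2)[OF pos mono[OF that] \<beta>(3,4)]
      unfolding w by (simp add: min_mult_distrib_right min_le_iff_disj)
    have "\<forall>\<^sub>F m in at_bot. \<nu> m * \<mu> m powr lam / abs_weight \<mu> \<beta> m
        = \<nu> m * \<mu> m powr lam / \<mu> m powr \<bar>\<beta>\<bar>"
      unfolding eventually_at_bot_linorder
      \<comment> \<open>The first branch of \<open>abs_weight\<close> asks for
        \<open>n < unit_index \<mu>\<close>, hence the bound shifted by one.\<close>
      by (rule exI[of _ "unit_index \<mu> - 1"]) (simp add: abs_weight_def)
    then show "((\<lambda>m. \<nu> m * \<mu> m powr lam / abs_weight \<mu> \<beta> m) \<longlongrightarrow> 0) at_bot"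
      by (rule iffD2[OF tendsto_cong]) (rule lim_bot, use assms in auto)
    have "\<forall>\<^sub>F m in at_top. \<nu> m * \<mu> m powr (- lam) / abs_weight \<mu> \<beta> m
        = \<nu> m * \<mu> m powr (- lam) / \<mu> m powr (- \<bar>\<beta>\<bar>)"
      using eventually_ge_at_top[of "unit_index \<mu>"]
      by eventually_elim (simp add: abs_weight_def)
    then show "((\<lambda>m. \<nu> m * \<mu> m powr (- lam) / abs_weight \<mu> \<beta> m) \<longlongrightarrow> 0) at_top"
      by (rule iffD2[OF tendsto_cong]) (rule lim_top, use assms in auto)
  qed
  show ?thesis
  proof (intro conjI ballI)
    fix y :: "int \<Rightarrow> 'a" assume "y \<in> l1 \<mu> \<nu> \<beta>"
    then show "\<exists>!x. x \<in> linf \<mu> \<beta> \<and> (\<forall>n. x (n + 1) - A n (x n) = y (n + 1))"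
      using std.ex1_bounded_solution[of y] unfolding l1_def linf_def mem_Collect_eq by blast
  next
    fix y :: "int \<Rightarrow> 'a" assume "y \<in> l1_abs \<mu> \<nu> \<beta>"
    then show "\<exists>!x. x \<in> linf_abs \<mu> \<beta> \<and> (\<forall>n. x (n + 1) - A n (x n) = y (n + 1))"
      unfolding linf_abs_iff by (intro abs.ex1_bounded_solution l1_abs_summable)
  qed
qed

end
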